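(* Assume (i) each $f_i$ is convex and $L_i$-smooth, and (ii) $f$ is $\mu$-strongly convex. Let $T$ be the number of iterations, $1\le\beta<T$, $\alpha=(\beta/T)^{1/T}$, and run SGD, $w_{k+1}=w_k-\gamma_k\alpha_k\nabla f_{i_k}(w_k)$, for $k=1,\dots,T$ with $\gamma_k=\frac1L$ and $\alpha_k=\left(\frac{\beta}{T}\right)^{k/T}$. Then $$\mathbb{E}\|w_{T+1}-w^*\|^2\le \|w_1-w^*\|^2\,c_2\exp\left(-\frac{T}{\kappa}\frac{\alpha}{\ln(T/\beta)}\right)+\frac{8\sigma^2c_2\kappa}{\mu e^2}\frac{(\ln(T/\beta))^2}{\alpha^2T},$$ where $c_2=\exp\left(\frac1\kappa\cdot\frac{2\beta}{\ln(T/\beta)}\right)$.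
   Context: $f:\mathbb{R}^d\to\mathbb{R}$ is $f(w)=\frac1n\sum_{i=1}^nf_i(w)$, where each $f_i:\mathbb{R}^d\to\mathbb{R}$ is differentiable and bounded below, with infimum $f_i^*$. $L_i$-smooth means $f_i(v)\le f_i(w)+\langle\nabla f_i(w),v-w\rangle+\frac{L_i}{2}\|v-w\|^2$ for all $v,w$. $f$ is $\mu$-strongly convex ($\mu>0$) if $f(v)\ge f(w)+\langle\nabla f(w),v-w\rangle+\frac\mu2\|v-w\|^2$ for all $v,w$. Set $L:=\max_iL_i$, $\kappa:=L/\mu$, let $w^*$ be the unique minimizer of $f$, and let $\sigma^2:=\mathbb{E}_i[f_i(w^* )-f_i^*]=\frac1n\sum_i(f_i(w^* )-f_i^* )$. In SGD, $w_1$ is a deterministic starting point and the indices $i_k$ are drawn independently and uniformly from $\{1,\dots,n\}$; $\mathbb{E}$ is over all these draws. *)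

theory Defs
  imports "HOL-Probability.Probability"
begin

definition grad :: "('a::real_inner \<Rightarrow> real) \<Rightarrow> 'a \<Rightarrow> 'a" where
  "grad g w = (THE D. GDERIV g w :> D)"

lemma grad_unique:
  assumes "GDERIV g w :> D"
  shows "grad g w = D"
  unfolding grad_def
proof (rule the_equality)
  show "GDERIV g w :> D" by fact
next
  fix D' assume "GDERIV g w :> D'"
  from this assms have eq: "(\<lambda>h. h \<bullet> D') = (\<lambda>h. h \<bullet> D)"
    unfolding gderiv_def by (rule has_derivative_unique)
  have "D' \<bullet> (D' - D) = D \<bullet> (D' - D)"
    using fun_cong[OF eq, of "D' - D"] by (simp add: inner_commute)
  then have "(D' - D) \<bullet> (D' - D) = 0"
    by (simp add: inner_diff_left)
  then show "D' = D" by simp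
qed

lemma gderiv_grad:
  fixes g :: "'a::euclidean_space \<Rightarrow> real"
  assumes "g differentiable (at w)"
  shows "GDERIV g w :> grad g w"
proof -
  obtain g' where g': "(g has_derivative g') (at w)"
    using assms unfolding differentiable_def by blast
  then interpret bounded_linear g' by (rule has_derivative_bounded_linear)
  define D where "D = (\<Sum>b\<in>Basis. g' b *\<^sub>R b)"
  have "g' h = h \<bullet> D" for h
  proof -
    have "g' h = g' (\<Sum>b\<in>Basis. (h \<bullet> b) *\<^sub>R b)" by (simp add: euclidean_representation)
    also have "\<dots> = (\<Sum>b\<in>Basis. (h \<bullet> b) * g' b)" by (simp add: sum scaleR)
    also have "\<dots> = h \<bullet> D" by (simp add: D_def inner_sum_right mult.commute)
    finally show ?thesis .
  qed
  then have "g' = (\<lambda>h. h \<bullet> D)" by (rule ext)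
  with g' have "GDERIV g w :> D" by (simp add: gderiv_def)
  with grad_unique[OF this] show ?thesis by simp
qed

definition smooth :: "real \<Rightarrow> ('a::real_inner \<Rightarrow> real) \<Rightarrow> bool" where
  "smooth L g \<longleftrightarrow>
    (\<forall>v w. g v \<le> g w + grad g w \<bullet> (v - w) + L / 2 * (norm (v - w))\<^sup>2)"

definition strongly_convex :: "real \<Rightarrow> ('a::real_inner \<Rightarrow> real) \<Rightarrow> bool" where
  "strongly_convex \<mu> g \<longleftrightarrow>
    (\<forall>v w. g v \<ge> g w + grad g w \<bullet> (v - w) + \<mu> / 2 * (norm (v - w))\<^sup>2)"

end

theory Submission
  imports Defs
begin

text \<open>
  Write \<open>\<eta>\<^sub>k = \<alpha>\<^sup>k / L\<close> for the step size and \<open>d\<^sub>k\<close> for the expected squared distance of the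
  \<open>k\<close>-th iterate to \<open>w\<^sup>*\<close>. Since every step size is at most \<open>1 / L\<close>, a single step contracts up to noise:
  expanding the square, strong convexity turns the cross term into a contraction and a gain of
  \<open>2 \<eta> (f(x) - f(w\<^sup>*))\<close>, while smoothness bounds the squared stochastic gradients on average by
  \<open>2 L (f(x) - f(w\<^sup>*) + \<sigma>\<^sup>2)\<close>, and the gain absorbs the part of this that depends on \<open>x\<close>
  (\<open>sgd_step_average\<close>). The fresh index is independent of the current iterate, so that this
  pointwise average is what enters the expectation (\<open>nn_integral_fresh_variable\<close>), and
  \[ d_{k+1} \le e^{-\mu\eta_k} d_k + 2 L \sigma^2 \eta_k^2 . \]
  Unrolling gives \<open>sgd_expected_square_distance\<close>, valid for any step sizes in \<open>[0, 1/L]\<close>.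

  For the exponential schedule, \<open>\<mu> \<eta>\<^sub>k = \<alpha>\<^sup>k / \<kappa>\<close>, and the geometric sums in the exponents are
  bounded below by \<open>geometric_tail_ge\<close>. The full sum yields the first term of the bound. In the
  noise term each summand is at most a constant times \<open>x\<^sup>2 e\<^sup>-\<^sup>x\<close> with \<open>x\<close> proportional to the
  step size, hence at most that constant times \<open>4 / e\<^sup>2\<close>, whatever the step size: summing \<open>T\<close> such
  terms gives the second term (\<open>exponential_schedule_noise_le\<close>).

  Expectations are handled as nonnegative integrals up to the last step, where the finite bound passes to
  the Bochner integral.
\<close>

section \<open>Smoothness, strong convexity and averages\<close>

lemma smooth_mono:
  fixes g :: "'a::real_inner \<Rightarrow> real"
  assumes "smooth L g" "L \<le> L'"
  shows "smooth L' g"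
  unfolding smooth_def
proof (intro allI)
  fix v w :: 'a
  have "L / 2 * (norm (v - w))\<^sup>2 \<le> L' / 2 * (norm (v - w))\<^sup>2"
    using assms(2) by (intro mult_right_mono) auto
  then show "g v \<le> g w + grad g w \<bullet> (v - w) + L' / 2 * (norm (v - w))\<^sup>2"
    using assms(1) unfolding smooth_def by (smt (verit))
qed

text \<open>
  One gradient step of length \<open>1 / L\<close> decreases \<open>g\<close> by at least \<open>\<parallel>\<nabla>g(x)\<parallel>\<^sup>2 / (2 L)\<close>, and the result
  cannot fall below the infimum.
\<close>

lemma smooth_norm_grad_le:
  assumes "smooth L g" "L > 0" "bdd_below (range g)"
  shows "(norm (grad g x))\<^sup>2 \<le> 2 * L * (g x - (INF y. g y))"
proof -
  define v where "v = x - (1 / L) *\<^sub>R grad g x"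
  have diff: "v - x = - ((1 / L) *\<^sub>R grad g x)"
    by (simp add: v_def)
  have "(INF y. g y) \<le> g v"
    using assms(3) by (intro cINF_lower) auto
  also have "g v \<le> g x + grad g x \<bullet> (v - x) + L / 2 * (norm (v - x))\<^sup>2"
    using assms(1) unfolding smooth_def by blast
  also have "\<dots> = g x - (norm (grad g x))\<^sup>2 / (2 * L)"
    using assms(2) unfolding diff norm_minus_cancel inner_minus_right
    by (simp add: power_mult_distrib dot_square_norm field_simps power2_eq_square)
  finally show ?thesis
    using assms(2) by (simp add: field_simps)
qed

lemma grad_average:
  fixes fs :: "nat \<Rightarrow> 'a::euclidean_space \<Rightarrow> real"
  assumes "\<forall>i\<in>{1..n}. \<forall>x. fs i differentiable (at x)"
  shows "grad (\<lambda>x. (1 / real n) * (\<Sum>i=1..n. fs i x)) x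
    = (1 / real n) *\<^sub>R (\<Sum>i=1..n. grad (fs i) x)"
proof (rule grad_unique)
  have "(fs i has_derivative (\<lambda>h. h \<bullet> grad (fs i) x)) (at x)" if "i \<in> {1..n}" for i
    using gderiv_grad[of "fs i" x] assms that by (simp add: gderiv_def)
  then have "((\<lambda>x. (1 / real n) * (\<Sum>i=1..n. fs i x)) has_derivative
      (\<lambda>h. (1 / real n) * (\<Sum>i=1..n. h \<bullet> grad (fs i) x))) (at x)"
    by (intro has_derivative_mult_right has_derivative_sum)
  then show "GDERIV (\<lambda>x. (1 / real n) * (\<Sum>i=1..n. fs i x)) x
      :> (1 / real n) *\<^sub>R (\<Sum>i=1..n. grad (fs i) x)"
    by (simp add: gderiv_def inner_sum_right)
qed

lemma smooth_average:
  fixes fs :: "nat \<Rightarrow> 'a::euclidean_space \<Rightarrow> real"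
  assumes "n \<ge> 1"
    and "\<forall>i\<in>{1..n}. \<forall>x. fs i differentiable (at x)"
    and "\<forall>i\<in>{1..n}. smooth L (fs i)"
  shows "smooth L (\<lambda>x. (1 / real n) * (\<Sum>i=1..n. fs i x))"
  unfolding smooth_def grad_average[OF assms(2)]
proof (intro allI)
  fix v w :: 'a
  have "(\<Sum>i=1..n. fs i v)
      \<le> (\<Sum>i=1..n. fs i w + grad (fs i) w \<bullet> (v - w) + L / 2 * (norm (v - w))\<^sup>2)"
    using assms(3) unfolding smooth_def by (intro sum_mono) blast
  also have "\<dots> = (\<Sum>i=1..n. fs i w) + (\<Sum>i=1..n. grad (fs i) w) \<bullet> (v - w)
      + real n * (L / 2 * (norm (v - w))\<^sup>2)"
    by (simp add: sum.distrib inner_sum_left)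
  finally show "1 / real n * (\<Sum>i=1..n. fs i v) \<le> 1 / real n * (\<Sum>i=1..n. fs i w)
      + ((1 / real n) *\<^sub>R (\<Sum>i=1..n. grad (fs i) w)) \<bullet> (v - w) + L / 2 * (norm (v - w))\<^sup>2"
    using assms(1) by (simp add: field_simps)
qed

text \<open>
  Compare the quadratic lower and upper bounds on \<open>g\<close> at two points at distance one. Together with
  \<open>\<mu> > 0\<close>, this is what makes \<open>L\<close> and \<open>\<kappa>\<close> positive in the theorem.
\<close>

lemma strong_convexity_le_smoothness:
  fixes g :: "'a::euclidean_space \<Rightarrow> real"
  assumes "strongly_convex \<mu> g" "smooth L g"
  shows "\<mu> \<le> L"
proof -
  obtain b :: 'a where b: "b \<in> Basis"
    using nonempty_Basis by blast
  have "g b \<ge> g 0 + grad g 0 \<bullet> (b - 0) + \<mu> / 2 * (norm (b - 0))\<^sup>2"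
    using assms(1) unfolding strongly_convex_def by blast
  moreover have "g b \<le> g 0 + grad g 0 \<bullet> (b - 0) + L / 2 * (norm (b - 0))\<^sup>2"
    using assms(2) unfolding smooth_def by blast
  ultimately show ?thesis
    using b by simp
qed

section \<open>One step of stochastic gradient descent\<close>

text \<open>
  The mean over \<open>i\<close> of the gaps \<open>f\<^sub>i(x) - f\<^sub>i\<^sup>*\<close> is \<open>(f(x) - f(w\<^sup>*)) + \<sigma>\<^sup>2\<close>. Its first part is multiplied
  by \<open>2 L \<eta>\<^sup>2 \<le> 2 \<eta>\<close> and is cancelled by the gain from strong convexity; only the noise level remains.
\<close>

lemma sgd_step_average:
  fixes fs :: "nat \<Rightarrow> 'a::euclidean_space \<Rightarrow> real"
  assumes n: "n \<ge> 1"
    and f: "f = (\<lambda>x. (1 / real n) * (\<Sum>i=1..n. fs i x))"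
    and diff: "\<forall>i\<in>{1..n}. \<forall>x. fs i differentiable (at x)"
    and bdd: "\<forall>i\<in>{1..n}. bdd_below (range (fs i))"
    and smooth: "\<forall>i\<in>{1..n}. smooth L (fs i)"
    and strong: "strongly_convex \<mu> f"
    and wstar: "\<forall>x. f wstar \<le> f x"
    and sigma2: "\<sigma>2 = (1 / real n) * (\<Sum>i=1..n. fs i wstar - (INF x. fs i x))"
    and L: "L > 0"
    and eta: "0 \<le> \<eta>" "\<eta> * L \<le> 1"
  shows "(\<Sum>i=1..n. (norm (x - \<eta> *\<^sub>R grad (fs i) x - wstar))\<^sup>2) / real n
    \<le> (1 - \<mu> * \<eta>) * (norm (x - wstar))\<^sup>2 + 2 * L * \<eta>\<^sup>2 * \<sigma>2"
proof -
  define d where "d = x - wstar"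
  have term_le: "(norm (x - \<eta> *\<^sub>R grad (fs i) x - wstar))\<^sup>2
      \<le> (norm d)\<^sup>2 - 2 * \<eta> * (grad (fs i) x \<bullet> d)
        + \<eta>\<^sup>2 * (2 * L * (fs i x - (INF y. fs i y)))" if "i \<in> {1..n}" for i
  proof -
    have "x - \<eta> *\<^sub>R grad (fs i) x - wstar = d - \<eta> *\<^sub>R grad (fs i) x"
      by (simp add: d_def)
    then have "(norm (x - \<eta> *\<^sub>R grad (fs i) x - wstar))\<^sup>2
        = (norm d)\<^sup>2 - 2 * \<eta> * (grad (fs i) x \<bullet> d) + \<eta>\<^sup>2 * (norm (grad (fs i) x))\<^sup>2"
      unfolding power2_norm_eq_inner
      by (simp add: inner_diff_left inner_diff_right inner_commute power2_eq_square algebra_simps)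
    moreover have "(norm (grad (fs i) x))\<^sup>2 \<le> 2 * L * (fs i x - (INF y. fs i y))"
      using that smooth bdd L by (intro smooth_norm_grad_le) auto
    ultimately show ?thesis
      by (simp add: mult_left_mono)
  qed
  have avg_grad: "(\<Sum>i=1..n. grad (fs i) x \<bullet> d) = real n * (grad f x \<bullet> d)"
    using n unfolding f grad_average[OF diff] by (simp add: inner_sum_left)
  have avg_gap: "(\<Sum>i=1..n. fs i x - (INF y. fs i y)) = real n * (f x - f wstar + \<sigma>2)"
    using n unfolding f sigma2 by (simp add: sum_subtractf field_simps)
  have "(\<Sum>i=1..n. (norm (x - \<eta> *\<^sub>R grad (fs i) x - wstar))\<^sup>2)
      \<le> (\<Sum>i=1..n. (norm d)\<^sup>2 - 2 * \<eta> * (grad (fs i) x \<bullet> d)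
        + \<eta>\<^sup>2 * (2 * L * (fs i x - (INF y. fs i y))))"
    using term_le by (rule sum_mono)
  also have "\<dots> = real n * (norm d)\<^sup>2 - 2 * \<eta> * (\<Sum>i=1..n. grad (fs i) x \<bullet> d)
      + \<eta>\<^sup>2 * (2 * L) * (\<Sum>i=1..n. fs i x - (INF y. fs i y))"
    by (simp only: sum.distrib sum_subtractf[of "\<lambda>_. (norm d)\<^sup>2"] sum_distrib_left mult.assoc) simp
  also have "\<dots> = real n * ((norm d)\<^sup>2 - 2 * \<eta> * (grad f x \<bullet> d)
      + \<eta>\<^sup>2 * (2 * L) * (f x - f wstar + \<sigma>2))"
    unfolding avg_grad avg_gap by (simp add: algebra_simps)
  finally have "(\<Sum>i=1..n. (norm (x - \<eta> *\<^sub>R grad (fs i) x - wstar))\<^sup>2) / real n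
      \<le> (norm d)\<^sup>2 - 2 * \<eta> * (grad f x \<bullet> d) + \<eta>\<^sup>2 * (2 * L) * (f x - f wstar + \<sigma>2)"
    using n by (simp add: field_simps)
  moreover have "2 * \<eta> * (f x - f wstar + \<mu> / 2 * (norm d)\<^sup>2) \<le> 2 * \<eta> * (grad f x \<bullet> d)"
  proof (rule mult_left_mono)
    have "f wstar \<ge> f x + grad f x \<bullet> (wstar - x) + \<mu> / 2 * (norm (wstar - x))\<^sup>2"
      using strong unfolding strongly_convex_def by blast
    moreover have "wstar - x = - d"
      by (simp add: d_def)
    ultimately show "f x - f wstar + \<mu> / 2 * (norm d)\<^sup>2 \<le> grad f x \<bullet> d"
      by simp
  qed (use eta in simp)
  \<comment> \<open>The step size restriction enters here: the leftover multiple of the optimality gap has the right sign.\<close>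
  moreover have "2 * \<eta> * (1 - \<eta> * L) * (f x - f wstar) \<ge> 0"
    using eta wstar by simp
  ultimately show ?thesis
    unfolding d_def[symmetric] by (simp add: algebra_simps power2_eq_square)
qed

section \<open>Expectation along the random recursion\<close>

text \<open>
  This takes the place of conditioning on the past. As the variables have countable range, the product
  space of finitely many of them is discrete, which makes every function of the past measurable.
\<close>

lemma (in prob_space) nn_integral_fresh_variable:
  fixes X :: "'i \<Rightarrow> 'a \<Rightarrow> 'b::countable"
    and h :: "'c \<Rightarrow> 'b \<Rightarrow> ennreal"
  assumes ind: "indep_vars (\<lambda>_. count_space UNIV) X I"
    and J: "finite J" "J \<subseteq> I" and k: "k \<in> I" "k \<notin> J"
    and Y: "\<forall>\<omega>\<in>space M. Y \<omega> = F (restrict (\<lambda>j. X j \<omega>) J)"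
    and p: "distr M (count_space UNIV) (X k) = measure_pmf p"
  shows "(\<integral>\<^sup>+\<omega>. h (Y \<omega>) (X k \<omega>) \<partial>M) = (\<integral>\<^sup>+\<omega>. (\<integral>\<^sup>+i. h (Y \<omega>) i \<partial>measure_pmf p) \<partial>M)"
proof -
  define P where "P = count_space (PiE J (\<lambda>_. UNIV :: 'b set))"
  define R where "R = (\<lambda>\<omega>. restrict (\<lambda>j. X j \<omega>) J)"
  \<comment> \<open>Independence of a pair requires both components to have the same type; hence the single
    variable is viewed as a family indexed by \<open>{k}\<close>.\<close>
  define Q where "Q = count_space (PiE {k} (\<lambda>_. UNIV :: 'b set))"
  define R' where "R' = (\<lambda>\<omega>. restrict (\<lambda>j. X j \<omega>) {k})"
  have P: "PiM J (\<lambda>_. count_space UNIV) = P" and Q: "PiM {k} (\<lambda>_. count_space UNIV) = Q"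
    unfolding P_def Q_def using J by (auto intro!: count_space_PiM_finite)
  have "indep_var P R Q R'"
    unfolding R_def R'_def P[symmetric] Q[symmetric] using J k
    by (intro indep_var_restrict[OF ind]) auto
  then have R_meas[measurable]: "R \<in> measurable M P" and R'_meas[measurable]: "R' \<in> measurable M Q"
    and joint: "distr M P R \<Otimes>\<^sub>M distr M Q R' = distr M (P \<Otimes>\<^sub>M Q) (\<lambda>\<omega>. (R \<omega>, R' \<omega>))"
    unfolding indep_var_distribution_eq by auto
  interpret R': prob_space "distr M Q R'"
    by (rule prob_space_distr) measurable
  have Xk: "X k \<in> measurable M (count_space UNIV)"
    using ind k unfolding indep_vars_def by auto
  have g: "(\<lambda>(s, t). h (F s) (t k)) \<in> borel_measurable (P \<Otimes>\<^sub>M Q)"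
    unfolding P_def Q_def using J
    by (intro measurable_pair_measure_countable1 countable_PiE) auto
  have sets_joint: "sets (distr M P R \<Otimes>\<^sub>M distr M Q R') = sets (P \<Otimes>\<^sub>M Q)"
    by (intro sets_pair_measure_cong) auto
  have inner: "(\<integral>\<^sup>+t. h y (t k) \<partial>distr M Q R') = (\<integral>\<^sup>+i. h y i \<partial>measure_pmf p)" for y
  proof -
    have "(\<integral>\<^sup>+t. h y (t k) \<partial>distr M Q R') = (\<integral>\<^sup>+\<omega>. h y (X k \<omega>) \<partial>M)"
      using R'_meas unfolding R'_def by (subst nn_integral_distr) (auto simp: Q_def)
    also have "\<dots> = (\<integral>\<^sup>+i. h y i \<partial>measure_pmf p)"
      unfolding p[symmetric] using Xk by (subst nn_integral_distr) auto
    finally show ?thesis .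
  qed
  have "(\<integral>\<^sup>+\<omega>. h (Y \<omega>) (X k \<omega>) \<partial>M) = (\<integral>\<^sup>+\<omega>. (\<lambda>(s, t). h (F s) (t k)) (R \<omega>, R' \<omega>) \<partial>M)"
    using Y by (intro nn_integral_cong) (simp add: R_def R'_def)
  also have "\<dots> = (\<integral>\<^sup>+z. (\<lambda>(s, t). h (F s) (t k)) z \<partial>(distr M P R \<Otimes>\<^sub>M distr M Q R'))"
    unfolding joint using g by (subst nn_integral_distr) auto
  also have "\<dots> = (\<integral>\<^sup>+s. (\<integral>\<^sup>+t. h (F s) (t k) \<partial>distr M Q R') \<partial>distr M P R)"
    using R'.nn_integral_fst[of "\<lambda>(s, t). h (F s) (t k)" "distr M P R"] g
    by (simp add: measurable_cong_sets[OF sets_joint refl])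
  also have "\<dots> = (\<integral>\<^sup>+\<omega>. (\<integral>\<^sup>+i. h (F (R \<omega>)) i \<partial>measure_pmf p) \<partial>M)"
    unfolding inner using R_meas by (rule nn_integral_distr) (auto simp: P_def)
  also have "\<dots> = (\<integral>\<^sup>+\<omega>. (\<integral>\<^sup>+i. h (Y \<omega>) i \<partial>measure_pmf p) \<partial>M)"
    using Y by (intro nn_integral_cong) (simp add: R_def)
  finally show ?thesis .
qed

text \<open>
  The iterate with number \<open>k + 1\<close> has used the variables \<open>X\<^sub>1, \<dots>, X\<^sub>k\<close> only, which makes the next one fresh
  in the sense of \<open>nn_integral_fresh_variable\<close>.
\<close>

lemma recursion_function_of_past:
  fixes w :: "nat \<Rightarrow> 'a \<Rightarrow> 'v" and X :: "nat \<Rightarrow> 'a \<Rightarrow> 'b"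
  assumes start: "\<forall>\<omega>\<in>\<Omega>. w 1 \<omega> = w1"
    and step: "\<forall>k\<in>{1..T}. \<forall>\<omega>\<in>\<Omega>. w (k + 1) \<omega> = G k (X k \<omega>) (w k \<omega>)"
    and "k \<le> T"
  shows "\<exists>F. \<forall>\<omega>\<in>\<Omega>. w (k + 1) \<omega> = F (restrict (\<lambda>j. X j \<omega>) {1..k})"
  using \<open>k \<le> T\<close>
proof (induction k)
  case 0
  then show ?case
    using start by (intro exI[of _ "\<lambda>_. w1"]) simp
next
  case (Suc k)
  obtain F where F: "\<forall>\<omega>\<in>\<Omega>. w (k + 1) \<omega> = F (restrict (\<lambda>j. X j \<omega>) {1..k})"
    using Suc.IH[OF Suc_leD[OF Suc.prems]] by blast
  define F' where "F' s = G (Suc k) (s (Suc k)) (F (restrict s {1..k}))" for s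
  have "w (Suc k + 1) \<omega> = F' (restrict (\<lambda>j. X j \<omega>) {1..Suc k})" if "\<omega> \<in> \<Omega>" for \<omega>
  proof -
    have "restrict (restrict (\<lambda>j. X j \<omega>) {1..Suc k}) {1..k} = restrict (\<lambda>j. X j \<omega>) {1..k}"
      by (auto simp: restrict_def)
    then show ?thesis
      using step[rule_format, of "Suc k" \<omega>] Suc.prems F that by (simp add: F'_def)
  qed
  then show ?case
    by blast
qed

text \<open>
  The one-step factor \<open>1 - \<mu> \<eta>\<close> is replaced by \<open>exp (- \<mu> \<eta>)\<close>, which is visibly nonnegative, as
  iterating the inequality requires, and turns products of factors into sums of step sizes.
\<close>

lemma (in prob_space) sgd_expected_square_distance:
  fixes fs :: "nat \<Rightarrow> 'v::euclidean_space \<Rightarrow> real"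
    and X :: "nat \<Rightarrow> 'a \<Rightarrow> nat"
  assumes n: "n \<ge> 1"
    and f: "f = (\<lambda>x. (1 / real n) * (\<Sum>i=1..n. fs i x))"
    and diff: "\<forall>i\<in>{1..n}. \<forall>x. fs i differentiable (at x)"
    and bdd: "\<forall>i\<in>{1..n}. bdd_below (range (fs i))"
    and smooth: "\<forall>i\<in>{1..n}. smooth L (fs i)"
    and strong: "strongly_convex \<mu> f"
    and wstar: "\<forall>x. f wstar \<le> f x"
    and sigma2: "\<sigma>2 = (1 / real n) * (\<Sum>i=1..n. fs i wstar - (INF x. fs i x))"
    and L: "L > 0"
    and eta: "\<forall>k\<in>{1..T}. 0 \<le> \<eta> k \<and> \<eta> k * L \<le> 1"
    and indep: "indep_vars (\<lambda>_. count_space UNIV) X {1..T}"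
    and unif: "\<forall>k\<in>{1..T}. distr M (count_space UNIV) (X k) = measure_pmf (pmf_of_set {1..n})"
    and start: "\<forall>\<omega>\<in>space M. w 1 \<omega> = w1"
    and sgd: "\<forall>k\<in>{1..T}. \<forall>\<omega>\<in>space M.
      w (k + 1) \<omega> = w k \<omega> - \<eta> k *\<^sub>R grad (fs (X k \<omega>)) (w k \<omega>)"
    and "k \<le> T"
  shows "(\<integral>\<^sup>+\<omega>. ennreal ((norm (w (k + 1) \<omega> - wstar))\<^sup>2) \<partial>M)
    \<le> ennreal (exp (- \<mu> * (\<Sum>i=1..k. \<eta> i)) * (norm (w1 - wstar))\<^sup>2
      + 2 * L * \<sigma>2 * (\<Sum>j=1..k. (\<eta> j)\<^sup>2 * exp (- \<mu> * (\<Sum>i=Suc j..k. \<eta> i))))"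
  using \<open>k \<le> T\<close>
proof (induction k)
  case 0
  have "(\<integral>\<^sup>+\<omega>. ennreal ((norm (w (0 + 1) \<omega> - wstar))\<^sup>2) \<partial>M)
      = (\<integral>\<^sup>+\<omega>. ennreal ((norm (w1 - wstar))\<^sup>2) \<partial>M)"
    using start by (intro nn_integral_cong) simp
  then show ?case
    by (simp add: emeasure_space_1)
next
  case (Suc k)
  define d where "d \<omega> = (norm (w (k + 1) \<omega> - wstar))\<^sup>2" for \<omega>
  define q where "q = exp (- \<mu> * \<eta> (Suc k))"
  define c where "c = 2 * L * \<sigma>2"
  define B where "B = (\<lambda>k. exp (- \<mu> * (\<Sum>i=1..k. \<eta> i)) * (norm (w1 - wstar))\<^sup>2
    + c * (\<Sum>j=1..k. (\<eta> j)\<^sup>2 * exp (- \<mu> * (\<Sum>i=Suc j..k. \<eta> i))))"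
  have mem: "Suc k \<in> {1..T}"
    using Suc.prems by simp
  have "\<sigma>2 \<ge> 0"
    unfolding sigma2 using bdd by (intro mult_nonneg_nonneg sum_nonneg) (auto intro: cINF_lower)
  then have c: "c \<ge> 0"
    using L by (simp add: c_def)
  have B_nonneg: "B k \<ge> 0"
    unfolding B_def using c by (intro add_nonneg_nonneg mult_nonneg_nonneg sum_nonneg) auto
  have B_Suc: "B (Suc k) = q * B k + c * (\<eta> (Suc k))\<^sup>2"
  proof -
    have "(\<Sum>j=1..k. (\<eta> j)\<^sup>2 * exp (- \<mu> * (\<Sum>i=Suc j..Suc k. \<eta> i)))
        = (\<Sum>j=1..k. q * ((\<eta> j)\<^sup>2 * exp (- \<mu> * (\<Sum>i=Suc j..k. \<eta> i))))"
      by (intro sum.cong refl) (simp add: q_def exp_add[symmetric] algebra_simps)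
    moreover have "exp (- \<mu> * (\<Sum>i=1..Suc k. \<eta> i)) = q * exp (- \<mu> * (\<Sum>i=1..k. \<eta> i))"
      by (simp add: q_def exp_add[symmetric] algebra_simps)
    ultimately show ?thesis
      unfolding B_def by (simp add: sum_distrib_left[symmetric] algebra_simps)
  qed
  obtain F where F: "\<forall>\<omega>\<in>space M. w (k + 1) \<omega> = F (restrict (\<lambda>j. X j \<omega>) {1..k})"
    using recursion_function_of_past[of "space M" w w1 T "\<lambda>k i x. x - \<eta> k *\<^sub>R grad (fs i) x" X k]
      start sgd Suc.prems by auto
  have d_meas [measurable]: "d \<in> borel_measurable M"
  proof -
    have "(\<lambda>\<omega>. restrict (\<lambda>j. X j \<omega>) {1..k}) \<in> measurable M (PiM {1..k} (\<lambda>_. count_space UNIV))"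
      using indep Suc.prems unfolding indep_vars_def by (intro measurable_restrict) auto
    then have "(\<lambda>\<omega>. restrict (\<lambda>j. X j \<omega>) {1..k})
        \<in> measurable M (count_space (PiE {1..k} (\<lambda>_. UNIV)))"
      by (subst (asm) count_space_PiM_finite) auto
    then have "(\<lambda>\<omega>. (norm (F (restrict (\<lambda>j. X j \<omega>) {1..k}) - wstar))\<^sup>2) \<in> borel_measurable M"
      by (rule measurable_compose) auto
    then show ?thesis
      by (rule measurable_cong[THEN iffD1, rotated]) (use F in \<open>simp add: d_def\<close>)
  qed
  have average: "(\<Sum>i=1..n. (norm (x - \<eta> (Suc k) *\<^sub>R grad (fs i) x - wstar))\<^sup>2) / real n
      \<le> q * (norm (x - wstar))\<^sup>2 + c * (\<eta> (Suc k))\<^sup>2" for x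
  proof -
    have "(\<Sum>i=1..n. (norm (x - \<eta> (Suc k) *\<^sub>R grad (fs i) x - wstar))\<^sup>2) / real n
        \<le> (1 - \<mu> * \<eta> (Suc k)) * (norm (x - wstar))\<^sup>2 + 2 * L * (\<eta> (Suc k))\<^sup>2 * \<sigma>2"
      using sgd_step_average[OF n f diff bdd smooth strong wstar sigma2 L] eta mem by blast
    moreover have "1 - \<mu> * \<eta> (Suc k) \<le> q"
      using exp_ge_add_one_self[of "- \<mu> * \<eta> (Suc k)"] by (simp add: q_def)
    then have "(1 - \<mu> * \<eta> (Suc k)) * (norm (x - wstar))\<^sup>2 \<le> q * (norm (x - wstar))\<^sup>2"
      by (rule mult_right_mono) simp
    ultimately show ?thesis
      by (simp add: c_def mult_ac)
  qed
  have "(\<integral>\<^sup>+\<omega>. ennreal ((norm (w (Suc k + 1) \<omega> - wstar))\<^sup>2) \<partial>M)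
      = (\<integral>\<^sup>+\<omega>. ennreal ((norm (w (k + 1) \<omega>
          - \<eta> (Suc k) *\<^sub>R grad (fs (X (Suc k) \<omega>)) (w (k + 1) \<omega>) - wstar))\<^sup>2) \<partial>M)"
    using sgd mem by (intro nn_integral_cong) simp
  also have "\<dots> = (\<integral>\<^sup>+\<omega>. (\<integral>\<^sup>+i. ennreal ((norm (w (k + 1) \<omega>
          - \<eta> (Suc k) *\<^sub>R grad (fs i) (w (k + 1) \<omega>) - wstar))\<^sup>2)
        \<partial>measure_pmf (pmf_of_set {1..n})) \<partial>M)"
    using nn_integral_fresh_variable[OF indep _ _ mem _ F unif[rule_format, OF mem],
        of "\<lambda>x i. ennreal ((norm (x - \<eta> (Suc k) *\<^sub>R grad (fs i) x - wstar))\<^sup>2)"] Suc.prems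
    by simp
  also have "\<dots> = (\<integral>\<^sup>+\<omega>. ennreal ((\<Sum>i=1..n. (norm (w (k + 1) \<omega>
          - \<eta> (Suc k) *\<^sub>R grad (fs i) (w (k + 1) \<omega>) - wstar))\<^sup>2) / real n) \<partial>M)"
    using n by (simp add: nn_integral_pmf_of_set sum_ennreal divide_ennreal sum_nonneg
        ennreal_of_nat_eq_real_of_nat)
  also have "\<dots> \<le> (\<integral>\<^sup>+\<omega>. ennreal (q * d \<omega> + c * (\<eta> (Suc k))\<^sup>2) \<partial>M)"
    unfolding d_def using average by (intro nn_integral_mono ennreal_leI)
  also have "\<dots> = (\<integral>\<^sup>+\<omega>. ennreal q * ennreal (d \<omega>) + ennreal (c * (\<eta> (Suc k))\<^sup>2) \<partial>M)"
    using c by (intro nn_integral_cong) (simp add: ennreal_plus ennreal_mult q_def d_def)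
  also have "\<dots> = ennreal q * (\<integral>\<^sup>+\<omega>. ennreal (d \<omega>) \<partial>M) + ennreal (c * (\<eta> (Suc k))\<^sup>2)"
    by (simp add: nn_integral_add nn_integral_cmult emeasure_space_1)
  also have "\<dots> \<le> ennreal q * ennreal (B k) + ennreal (c * (\<eta> (Suc k))\<^sup>2)"
    using Suc by (intro add_right_mono mult_left_mono) (auto simp: B_def c_def d_def)
  also have "\<dots> = ennreal (B (Suc k))"
    using B_nonneg c unfolding B_Suc by (simp add: ennreal_plus ennreal_mult q_def)
  finally show ?case
    unfolding B_def c_def .
qed

section \<open>The exponential step size schedule\<close>

text \<open>
  The maximum is attained at \<open>x = 2\<close>; squaring the tangent line bound \<open>x / 2 \<le> exp (x / 2 - 1)\<close> avoids
  calculus.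
\<close>

lemma square_mult_exp_minus_le:
  fixes x :: real
  assumes "0 \<le> x"
  shows "x\<^sup>2 * exp (- x) \<le> 4 / (exp 1)\<^sup>2"
proof -
  have "x / 2 \<le> exp (x / 2 - 1)"
    using exp_ge_add_one_self[of "x / 2 - 1"] by simp
  then have "(x / 2)\<^sup>2 \<le> (exp (x / 2 - 1))\<^sup>2"
    using assms by (intro power_mono) auto
  also have "\<dots> = exp x / (exp 1)\<^sup>2"
    by (simp add: exp_double[symmetric] exp_diff[symmetric])
  finally show ?thesis
    by (simp add: exp_minus field_simps)
qed

text \<open>
  The tail equals \<open>(\<alpha>\<^bsup>k+1\<^esup> - \<alpha>\<^bsup>T+1\<^esup>) / (1 - \<alpha>)\<close>. Here \<open>1 - \<alpha> \<le> - ln \<alpha> = ln (T / \<beta>) / T\<close>, and the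
  subtracted term satisfies \<open>T \<alpha>\<^bsup>T+1\<^esup> = \<alpha> \<beta> \<le> \<beta>\<close>.
\<close>

lemma geometric_tail_ge:
  fixes \<alpha> \<beta> :: real
  assumes beta: "0 < \<beta>" "\<beta> < real T" and alpha: "0 < \<alpha>" "\<alpha> ^ T = \<beta> / real T" and k: "k \<le> T"
  shows "(\<alpha> ^ Suc k * real T - \<beta>) / ln (real T / \<beta>) \<le> (\<Sum>i=Suc k..T. \<alpha> ^ i)"
proof -
  have T: "T > 0" "real T > 0"
    using beta by (auto intro: gr0I)
  have l: "ln (real T / \<beta>) > 0"
    using beta by simp
  have lt1: "\<alpha> < 1"
  proof (rule ccontr)
    assume "\<not> \<alpha> < 1"
    then have "\<alpha> ^ T \<ge> 1" by (simp add: one_le_power)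
    then show False using alpha beta by (simp add: field_simps)
  qed
  have "real T * ln \<alpha> = ln (\<alpha> ^ T)"
    using alpha by (simp only: alpha(2)[symmetric] ln_realpow)
  also have "\<dots> = - ln (real T / \<beta>)"
    using alpha beta T by (simp add: ln_div)
  finally have "ln (real T / \<beta>) = real T * (- ln \<alpha>)"
    by simp
  moreover have "1 - \<alpha> \<le> - ln \<alpha>"
    using ln_le_minus_one[OF alpha(1)] by simp
  ultimately have gap: "real T * (1 - \<alpha>) \<le> ln (real T / \<beta>)"
    using T by (simp only: mult_left_mono less_imp_le)
  have tail: "(1 - \<alpha>) * (\<Sum>i=Suc k..T. \<alpha> ^ i) = \<alpha> ^ Suc k - \<alpha> ^ Suc T"
    using k sum_gp_multiplied[of "Suc k" T \<alpha>] by (cases "k = T") auto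
  have nonneg: "0 \<le> (\<Sum>i=Suc k..T. \<alpha> ^ i)"
    using alpha by (intro sum_nonneg) auto
  have "\<alpha> ^ Suc T * real T = \<alpha> * \<beta>"
    using alpha T by simp
  also have "\<dots> \<le> \<beta>"
    using lt1 beta by simp
  finally have "\<alpha> ^ Suc k * real T - \<beta> \<le> real T * (\<alpha> ^ Suc k - \<alpha> ^ Suc T)"
    by (simp add: algebra_simps)
  also have "\<dots> = real T * (1 - \<alpha>) * (\<Sum>i=Suc k..T. \<alpha> ^ i)"
    unfolding tail[symmetric] by simp
  also have "\<dots> \<le> ln (real T / \<beta>) * (\<Sum>i=Suc k..T. \<alpha> ^ i)"
    using gap nonneg by (rule mult_right_mono)
  finally show ?thesis
    using l by (simp add: field_simps)
qed


text \<open>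
  Early steps are large but are discounted by all later ones, late steps are small. The inequality
  \<open>x\<^sup>2 e\<^sup>-\<^sup>x \<le> 4 / e\<^sup>2\<close> balances the two effects uniformly: it bounds every summand by the same quantity,
  which is of order \<open>1 / T\<^sup>2\<close> up to the logarithm.
\<close>

lemma exponential_schedule_noise_le:
  fixes \<alpha> \<beta> \<kappa> c :: real
  assumes beta: "0 < \<beta>" "\<beta> < real T" and alpha: "0 < \<alpha>" "\<alpha> ^ T = \<beta> / real T" and kappa: "0 < \<kappa>"
  shows "(\<Sum>j=1..T. (\<alpha> ^ j)\<^sup>2 * exp (- (1 / \<kappa>) * (\<Sum>i=Suc j..T. \<alpha> ^ i)))
    \<le> exp ((1 / \<kappa>) * (\<beta> / ln (real T / \<beta>)))
      * (4 * \<kappa>\<^sup>2 / (exp 1)\<^sup>2 * ((ln (real T / \<beta>))\<^sup>2 / (\<alpha>\<^sup>2 * real T)))"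
proof -
  define l where "l = ln (real T / \<beta>)"
  define C where "C = exp ((1 / \<kappa>) * (\<beta> / l))"
  have T: "real T > 0"
    using beta by simp
  have l: "l > 0"
    using beta by (simp add: l_def)
  have "(\<alpha> ^ j)\<^sup>2 * exp (- (1 / \<kappa>) * (\<Sum>i=Suc j..T. \<alpha> ^ i))
      \<le> C * (4 * \<kappa>\<^sup>2 / (exp 1)\<^sup>2 * (l\<^sup>2 / (\<alpha>\<^sup>2 * (real T)\<^sup>2)))" if "j \<in> {1..T}" for j
  proof -
    \<comment> \<open>The exponent is essentially \<open>- x\<close>, and the squared step size is a multiple of \<open>x\<^sup>2\<close>.\<close>
    define x where "x = \<alpha> ^ Suc j * real T / (\<kappa> * l)"
    have x: "x \<ge> 0"
      using alpha kappa l by (simp add: x_def)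
    have "(\<alpha> ^ Suc j * real T - \<beta>) / l \<le> (\<Sum>i=Suc j..T. \<alpha> ^ i)"
      unfolding l_def using geometric_tail_ge[OF beta alpha] that by simp
    then have "- (1 / \<kappa>) * (\<Sum>i=Suc j..T. \<alpha> ^ i) \<le> - (1 / \<kappa>) * ((\<alpha> ^ Suc j * real T - \<beta>) / l)"
      using kappa by (intro mult_left_mono_neg) auto
    also have "\<dots> = (1 / \<kappa>) * (\<beta> / l) + - x"
      using kappa l by (simp add: x_def field_simps)
    finally have "exp (- (1 / \<kappa>) * (\<Sum>i=Suc j..T. \<alpha> ^ i)) \<le> C * exp (- x)"
      unfolding C_def exp_add[symmetric] by simp
    moreover have "(\<alpha> ^ j)\<^sup>2 = x\<^sup>2 * (\<kappa>\<^sup>2 * l\<^sup>2 / (\<alpha>\<^sup>2 * (real T)\<^sup>2))"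
      using alpha kappa l T by (simp add: x_def field_simps power2_eq_square)
    ultimately have "(\<alpha> ^ j)\<^sup>2 * exp (- (1 / \<kappa>) * (\<Sum>i=Suc j..T. \<alpha> ^ i))
        \<le> x\<^sup>2 * (\<kappa>\<^sup>2 * l\<^sup>2 / (\<alpha>\<^sup>2 * (real T)\<^sup>2)) * (C * exp (- x))"
      by (simp only:) (intro mult_left_mono, auto)
    also have "\<dots> = C * (\<kappa>\<^sup>2 * l\<^sup>2 / (\<alpha>\<^sup>2 * (real T)\<^sup>2)) * (x\<^sup>2 * exp (- x))"
      by (simp add: mult_ac)
    also have "\<dots> \<le> C * (\<kappa>\<^sup>2 * l\<^sup>2 / (\<alpha>\<^sup>2 * (real T)\<^sup>2)) * (4 / (exp 1)\<^sup>2)"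
      using square_mult_exp_minus_le[OF x] by (intro mult_left_mono) (auto simp: C_def)
    finally show ?thesis
      by (simp add: mult_ac)
  qed
  then have "(\<Sum>j=1..T. (\<alpha> ^ j)\<^sup>2 * exp (- (1 / \<kappa>) * (\<Sum>i=Suc j..T. \<alpha> ^ i)))
      \<le> (\<Sum>j=1..T. C * (4 * \<kappa>\<^sup>2 / (exp 1)\<^sup>2 * (l\<^sup>2 / (\<alpha>\<^sup>2 * (real T)\<^sup>2))))"
    by (rule sum_mono)
  also have "\<dots> = C * (4 * \<kappa>\<^sup>2 / (exp 1)\<^sup>2 * (l\<^sup>2 / (\<alpha>\<^sup>2 * real T)))"
    using T by (simp add: power2_eq_square)
  finally show ?thesis
    unfolding C_def l_def .
qed

section \<open>The convergence rate\<close>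

theorem theorem1:
  fixes n T :: nat
    and fs :: "nat \<Rightarrow> real ^ 'd \<Rightarrow> real"
    and f :: "real ^ 'd \<Rightarrow> real"
    and Ls :: "nat \<Rightarrow> real"
    and L \<mu> \<kappa> \<sigma>2 \<beta> \<alpha> c2 :: real
    and w1 wstar :: "real ^ 'd"
    and \<gamma> \<alpha>s :: "nat \<Rightarrow> real"
    and M :: "'\<omega> measure"
    and idx :: "nat \<Rightarrow> '\<omega> \<Rightarrow> nat"
    and w :: "nat \<Rightarrow> '\<omega> \<Rightarrow> real ^ 'd"
  assumes n: "n \<ge> 1"
    and f: "f = (\<lambda>x. (1 / real n) * (\<Sum>i=1..n. fs i x))"
    and diff: "\<forall>i\<in>{1..n}. \<forall>x. fs i differentiable (at x)"
    and bdd: "\<forall>i\<in>{1..n}. bdd_below (range (fs i))"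
    and convex: "\<forall>i\<in>{1..n}. convex_on UNIV (fs i)"
    and smooth: "\<forall>i\<in>{1..n}. smooth (Ls i) (fs i)"
    and mu: "\<mu> > 0"
    and strong: "strongly_convex \<mu> f"
    and L: "L = Max (Ls ` {1..n})"
    and kappa: "\<kappa> = L / \<mu>"
    and wstar: "\<forall>x. f wstar \<le> f x"
    and sigma2: "\<sigma>2 = (1 / real n) * (\<Sum>i=1..n. fs i wstar - (INF x. fs i x))"
    and beta: "1 \<le> \<beta>" "\<beta> < real T"
    and alpha: "\<alpha> = (\<beta> / real T) powr (1 / real T)"
    and gamma: "\<forall>k\<in>{1..T}. \<gamma> k = 1 / L"
    and alphas: "\<forall>k\<in>{1..T}. \<alpha>s k = (\<beta> / real T) powr (real k / real T)"
    and c2: "c2 = exp ((1 / \<kappa>) * (2 * \<beta> / ln (real T / \<beta>)))"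
    and prob: "prob_space M"
    and indep: "prob_space.indep_vars M (\<lambda>_. count_space UNIV) idx {1..T}"
    and unif: "\<forall>k\<in>{1..T}. distr M (count_space UNIV) (idx k) = measure_pmf (pmf_of_set {1..n})"
    and start: "\<forall>\<omega>\<in>space M. w 1 \<omega> = w1"
    and sgd: "\<forall>k\<in>{1..T}. \<forall>\<omega>\<in>space M.
      w (k + 1) \<omega> = w k \<omega> - (\<gamma> k * \<alpha>s k) *\<^sub>R grad (fs (idx k \<omega>)) (w k \<omega>)"
  shows "prob_space.expectation M (\<lambda>\<omega>. (norm (w (T + 1) \<omega> - wstar))\<^sup>2)
    \<le> (norm (w1 - wstar))\<^sup>2 * c2 * exp (- (real T / \<kappa>) * (\<alpha> / ln (real T / \<beta>)))
      + (8 * \<sigma>2 * c2 * \<kappa>) / (\<mu> * (exp 1)\<^sup>2) * ((ln (real T / \<beta>))\<^sup>2 / (\<alpha>\<^sup>2 * real T))"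
proof -
  interpret prob_space M by (rule prob)
  have smooth_L: "\<forall>i\<in>{1..n}. smooth L (fs i)"
    using smooth smooth_mono unfolding L by (metis Max_ge finite_atLeastAtMost finite_imageI imageI)
  have "\<mu> \<le> L"
    using strong_convexity_le_smoothness[OF strong] smooth_average[OF n diff smooth_L]
    unfolding f by blast
  then have L_pos: "L > 0"
    using mu by simp
  have kappa_pos: "\<kappa> > 0"
    using L_pos mu by (simp add: kappa)
  have T: "T \<ge> 1" "real T > 0"
    using beta by auto
  have beta_pos: "\<beta> > 0"
    using beta by simp
  have alpha_pos: "\<alpha> > 0"
    using beta T by (simp add: alpha)
  have alphas_eq: "\<alpha>s k = \<alpha> ^ k" if "k \<in> {1..T}" for k
    using that alphas alpha_pos unfolding alpha by (simp add: powr_powr powr_realpow[symmetric])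
  have alpha_T: "\<alpha> ^ T = \<beta> / real T"
    using alphas_eq[of T] alphas T beta by simp
  have "\<alpha> \<le> 1"
    unfolding alpha using beta T by (intro powr_le1) auto
  then have alpha_le1: "\<alpha> ^ k \<le> 1" for k
    using alpha_pos by (intro power_le_one) auto
  define \<eta> where "\<eta> k = \<alpha> ^ k / L" for k
  have eta: "\<forall>k\<in>{1..T}. 0 \<le> \<eta> k \<and> \<eta> k * L \<le> 1"
    using alpha_pos alpha_le1 L_pos by (simp add: \<eta>_def)
  have sgd_eta: "\<forall>k\<in>{1..T}. \<forall>\<omega>\<in>space M.
      w (k + 1) \<omega> = w k \<omega> - \<eta> k *\<^sub>R grad (fs (idx k \<omega>)) (w k \<omega>)"
    using sgd gamma alphas_eq by (simp add: \<eta>_def)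
  have mu_eta: "- \<mu> * (\<Sum>i\<in>A. \<eta> i) = - (1 / \<kappa>) * (\<Sum>i\<in>A. \<alpha> ^ i)" for A
    using mu L_pos by (simp add: \<eta>_def kappa sum_divide_distrib[symmetric])
  have c2_ge: "exp ((1 / \<kappa>) * (\<beta> / ln (real T / \<beta>))) \<le> c2"
    unfolding c2 using kappa_pos beta beta_pos by (auto intro!: divide_right_mono mult_left_mono)
  define E where "E = (\<Sum>j=1..T. (\<alpha> ^ j)\<^sup>2 * exp (- (1 / \<kappa>) * (\<Sum>i=Suc j..T. \<alpha> ^ i)))"
  define B where "B = exp (- (1 / \<kappa>) * (\<Sum>i=1..T. \<alpha> ^ i)) * (norm (w1 - wstar))\<^sup>2
    + 2 * \<sigma>2 / L * E"
  have sigma2_nonneg: "\<sigma>2 \<ge> 0"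
    unfolding sigma2 using bdd by (intro mult_nonneg_nonneg sum_nonneg) (auto intro: cINF_lower)
  have "(\<Sum>j=1..T. (\<eta> j)\<^sup>2 * exp (- (1 / \<kappa>) * (\<Sum>i=Suc j..T. \<alpha> ^ i))) = E / L\<^sup>2"
    by (simp add: E_def \<eta>_def power_divide sum_divide_distrib)
  then have "(\<integral>\<^sup>+\<omega>. ennreal ((norm (w (T + 1) \<omega> - wstar))\<^sup>2) \<partial>M) \<le> ennreal B"
    using sgd_expected_square_distance[OF n f diff bdd smooth_L strong wstar sigma2 L_pos eta
        indep unif start sgd_eta order_refl] L_pos
    unfolding mu_eta B_def by (simp add: power2_eq_square mult_ac)
  moreover have "B \<ge> 0"
    unfolding B_def E_def using sigma2_nonneg L_pos
    by (intro add_nonneg_nonneg mult_nonneg_nonneg sum_nonneg) auto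
  ultimately have "expectation (\<lambda>\<omega>. (norm (w (T + 1) \<omega> - wstar))\<^sup>2) \<le> B"
    by (intro integral_real_bounded)
  also have "B \<le> (norm (w1 - wstar))\<^sup>2 * c2 * exp (- (real T / \<kappa>) * (\<alpha> / ln (real T / \<beta>)))
      + (8 * \<sigma>2 * c2 * \<kappa>) / (\<mu> * (exp 1)\<^sup>2) * ((ln (real T / \<beta>))\<^sup>2 / (\<alpha>\<^sup>2 * real T))"
    unfolding B_def
  proof (rule add_mono)
    have "(\<alpha> * real T - \<beta>) / ln (real T / \<beta>) \<le> (\<Sum>i=1..T. \<alpha> ^ i)"
      using geometric_tail_ge[OF beta_pos beta(2) alpha_pos alpha_T, of 0] by simp
    then have "- (1 / \<kappa>) * (\<Sum>i=1..T. \<alpha> ^ i)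
        \<le> - (1 / \<kappa>) * ((\<alpha> * real T - \<beta>) / ln (real T / \<beta>))"
      using kappa_pos by (intro mult_left_mono_neg) auto
    also have "\<dots> = (1 / \<kappa>) * (\<beta> / ln (real T / \<beta>))
        + - (real T / \<kappa>) * (\<alpha> / ln (real T / \<beta>))"
      by (simp add: diff_divide_distrib algebra_simps)
    finally have "exp (- (1 / \<kappa>) * (\<Sum>i=1..T. \<alpha> ^ i))
        \<le> exp ((1 / \<kappa>) * (\<beta> / ln (real T / \<beta>))) * exp (- (real T / \<kappa>) * (\<alpha> / ln (real T / \<beta>)))"
      unfolding exp_add[symmetric] by simp
    also have "\<dots> \<le> c2 * exp (- (real T / \<kappa>) * (\<alpha> / ln (real T / \<beta>)))"
      using c2_ge by (rule mult_right_mono) simp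
    finally have "exp (- (1 / \<kappa>) * (\<Sum>i=1..T. \<alpha> ^ i)) * (norm (w1 - wstar))\<^sup>2
        \<le> (c2 * exp (- (real T / \<kappa>) * (\<alpha> / ln (real T / \<beta>)))) * (norm (w1 - wstar))\<^sup>2"
      by (rule mult_right_mono) simp
    then show "exp (- (1 / \<kappa>) * (\<Sum>i=1..T. \<alpha> ^ i)) * (norm (w1 - wstar))\<^sup>2
        \<le> (norm (w1 - wstar))\<^sup>2 * c2 * exp (- (real T / \<kappa>) * (\<alpha> / ln (real T / \<beta>)))"
      by (simp only: mult_ac)
  next
    have "E \<le> exp ((1 / \<kappa>) * (\<beta> / ln (real T / \<beta>)))
        * (4 * \<kappa>\<^sup>2 / (exp 1)\<^sup>2 * ((ln (real T / \<beta>))\<^sup>2 / (\<alpha>\<^sup>2 * real T)))"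
      unfolding E_def
      by (rule exponential_schedule_noise_le[OF beta_pos beta(2) alpha_pos alpha_T kappa_pos])
    also have "\<dots> \<le> c2 * (4 * \<kappa>\<^sup>2 / (exp 1)\<^sup>2 * ((ln (real T / \<beta>))\<^sup>2 / (\<alpha>\<^sup>2 * real T)))"
      using c2_ge by (rule mult_right_mono) simp
    finally have "2 * \<sigma>2 / L * E \<le> 2 * \<sigma>2 / L * (c2
        * (4 * \<kappa>\<^sup>2 / (exp 1)\<^sup>2 * ((ln (real T / \<beta>))\<^sup>2 / (\<alpha>\<^sup>2 * real T))))"
      by (rule mult_left_mono) (use sigma2_nonneg L_pos in simp)
    also have "\<dots> = (8 * \<sigma>2 * c2 * (\<kappa>\<^sup>2 / L)) / (exp 1)\<^sup>2
        * ((ln (real T / \<beta>))\<^sup>2 / (\<alpha>\<^sup>2 * real T))"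
      by simp
    also have "\<kappa>\<^sup>2 / L = \<kappa> / \<mu>"
      using L_pos by (simp add: kappa power2_eq_square)
    finally show "2 * \<sigma>2 / L * E
        \<le> (8 * \<sigma>2 * c2 * \<kappa>) / (\<mu> * (exp 1)\<^sup>2) * ((ln (real T / \<beta>))\<^sup>2 / (\<alpha>\<^sup>2 * real T))"
      by simp
  qed
  finally show ?thesis .
qed

end
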